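(* There does not exist a Sasaki-like almost contact complex Riemannian manifold $(\mathcal{M},\varphi,\xi,\eta,g)$ equipped with a $g$-generated Yamabe almost soliton having a vertical potential. That is, on a Sasaki-like almost contact complex Riemannian manifold $(\mathcal{M},\varphi,\xi,\eta,g)$ there are no vector field $\vartheta=k\,\xi$, with $k$ a differentiable function on $\mathcal{M}$ satisfying $k(p)\neq 0$ at every point $p\in\mathcal{M}$, and differentiable function $\lambda$ on $\mathcal{M}$ such that $\frac12\mathcal{L}_{\vartheta}g=(\tau-\lambda)g$, where $\tau$ is the scalar curvature of $g$.
   Context: An almost contact complex Riemannian (accR) manifold, also called an almost contact B-metric manifold, $(\mathcal{M},\varphi,\xi,\eta,g)$ is a differentiable (smooth, nonempty) manifold $\mathcal{M}$ of dimension $2n+1$, $n\geq 1$, with an endomorphism $\varphi$ of the tangent bundle $T\mathcal{M}$, a vector field $\xi$ (the Reeb vector field), a 1-form $\eta$ and a pseudo-Riemannian metric $g$ of signature $(n+1,n)$ such that $$\varphi\xi=0,\quad \varphi^2=-\mathrm{Id}+\eta\otimes\xi,\quad \eta\circ\varphi=0,\quad \eta(\xi)=1,\quad g(\varphi x,\varphi y)=-g(x,y)+\eta(x)\eta(y)$$ for all vector fields $x,y$. Let $\nabla$ be the Levi-Civita connection of $g$. The accR manifold is called Sasaki-like if $$(\nabla_x\varphi)y=\eta(y)\varphi^2x+g(\varphi x,\varphi y)\xi$$ for all vector fields $x,y$. A Yamabe almost soliton generated by $g$, denoted $(g;\vartheta,\lambda)$, consists of a vector field $\vartheta$ (the potential)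 and a differentiable function $\lambda$ (the soliton function) on $\mathcal{M}$ with $\frac12\mathcal{L}_{\vartheta}g=(\tau-\lambda)g$, where $\mathcal{L}$ is the Lie derivative and $\tau$ is the scalar curvature of $g$. The potential is vertical if $\vartheta=k\,\xi$ for a differentiable function $k$ on $\mathcal{M}$ with $k(p)\neq0$ at every point $p\in\mathcal{M}$. *)

theory Defs
  imports "HOL-Analysis.Analysis" "HOL-Library.Function_Algebras"
begin

section \<open>Pointwise real vector space structure on functions\<close>

text \<open>Tangent vectors are derivations, i.e. functions on functions, and vector fields are functions
  into tangent vectors.  With this instance (and the pointwise ring operations of
  \<^theory>\<open>HOL-Library.Function_Algebras\<close>) the operations \<open>+\<close>, \<open>-\<close>, \<open>*\<^sub>R\<close> and \<open>span\<close> apply to them.\<close>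

instantiation "fun" :: (type, real_vector) real_vector
begin

definition scaleR_fun :: "real \<Rightarrow> ('a \<Rightarrow> 'b) \<Rightarrow> 'a \<Rightarrow> 'b" where
  "scaleR_fun c f = (\<lambda>x. c *\<^sub>R f x)"

instance
  by standard (auto simp: scaleR_fun_def fun_eq_iff scaleR_add_right scaleR_add_left)

end

section \<open>Smooth manifolds\<close>

text \<open>\<open>Ck_on k S f\<close>: for open \<open>S\<close>, the map \<open>f\<close> is \<open>k\<close> times continuously differentiable on \<open>S\<close>.\<close>

fun Ck_on :: "nat \<Rightarrow> 'e::euclidean_space set \<Rightarrow> ('e \<Rightarrow> 'b::real_normed_vector) \<Rightarrow> bool" where
  "Ck_on 0 S f \<longleftrightarrow> continuous_on S f"
| "Ck_on (Suc k) S f \<longleftrightarrow> (\<forall>x\<in>S. f differentiable (at x)) \<and>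
     (\<forall>v. Ck_on k S (\<lambda>x. frechet_derivative f (at x) v))"

definition smooth_on :: "'e::euclidean_space set \<Rightarrow> ('e \<Rightarrow> 'b::real_normed_vector) \<Rightarrow> bool" where
  "smooth_on S f \<longleftrightarrow> (\<forall>k. Ck_on k S f)"

text \<open>A chart is a pair \<open>(U, c)\<close> of its domain and its coordinate map; values of \<open>c\<close> off \<open>U\<close> are
  irrelevant.  The atlas need not be maximal.\<close>

record ('a, 'e) charted_space =
  top_of :: "'a topology"
  atlas :: "('a set \<times> ('a \<Rightarrow> 'e)) set"

definition points :: "('a, 'e) charted_space \<Rightarrow> 'a set" where
  "points M = topspace (top_of M)"

definition smooth_manifold :: "('a, 'e::euclidean_space) charted_space \<Rightarrow> bool" where
  "smooth_manifold M \<longleftrightarrow>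
     points M \<noteq> {} \<and>
     Hausdorff_space (top_of M) \<and> second_countable (top_of M) \<and>
     (\<Union>(U, c)\<in>atlas M. U) = points M \<and>
     (\<forall>(U, c)\<in>atlas M. openin (top_of M) U \<and> open (c ` U) \<and>
        homeomorphic_map (subtopology (top_of M) U) (top_of_set (c ` U)) c) \<and>
     (\<forall>(U, c)\<in>atlas M. \<forall>(V, d)\<in>atlas M. smooth_on (c ` (U \<inter> V)) (d \<circ> inv_into U c))"

definition smooth_functions :: "('a, 'e::euclidean_space) charted_space \<Rightarrow> ('a \<Rightarrow> real) set" where
  "smooth_functions M = {f. \<forall>(U, c)\<in>atlas M. smooth_on (c ` U) (f \<circ> inv_into U c)}"

type_synonym 'a tangent_vector = "('a \<Rightarrow> real) \<Rightarrow> real"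

text \<open>The tangent space at \<open>p\<close> consists of the derivations at \<open>p\<close> of the algebra of smooth functions.
  As HOL functions are total, a derivation is fixed to be \<open>0\<close> on non-smooth arguments, so that
  equality of tangent vectors is equality of functions.  (Two functions agreeing on \<open>points M\<close>
  have the same image under a derivation at \<open>p \<in> points M\<close>, by the Leibniz rule.)\<close>

definition tangent_space ::
  "('a, 'e::euclidean_space) charted_space \<Rightarrow> 'a \<Rightarrow> 'a tangent_vector set" where
  "tangent_space M p = {v.
     (\<forall>f. f \<notin> smooth_functions M \<longrightarrow> v f = 0) \<and>
     (\<forall>f\<in>smooth_functions M. \<forall>h\<in>smooth_functions M.
        v (f + h) = v f + v h \<and> v (f * h) = f p * v h + h p * v f) \<and>
     (\<forall>a. \<forall>f\<in>smooth_functions M. v (a *\<^sub>R f) = a * v f)}"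

section \<open>Tensor fields\<close>

text \<open>All fields below are only relevant at the points of \<open>M\<close>, and identities between them are
  required there only.\<close>

type_synonym 'a vfield = "'a \<Rightarrow> 'a tangent_vector"
type_synonym 'a endo_field = "'a \<Rightarrow> 'a tangent_vector \<Rightarrow> 'a tangent_vector"
type_synonym 'a form_field = "'a \<Rightarrow> 'a tangent_vector \<Rightarrow> real"
type_synonym 'a bilinear_field = "'a \<Rightarrow> 'a tangent_vector \<Rightarrow> 'a tangent_vector \<Rightarrow> real"
type_synonym 'a connection = "'a vfield \<Rightarrow> 'a vfield \<Rightarrow> 'a vfield"

definition vector_fields :: "('a, 'e::euclidean_space) charted_space \<Rightarrow> 'a vfield set" where
  "vector_fields M = {X. (\<forall>p\<in>points M. X p \<in> tangent_space M p) \<and>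
     (\<forall>f\<in>smooth_functions M. (\<lambda>p. X p f) \<in> smooth_functions M)}"

definition linear_map_on :: "'v::real_vector set \<Rightarrow> ('v \<Rightarrow> 'w::real_vector) \<Rightarrow> bool" where
  "linear_map_on V T \<longleftrightarrow> (\<forall>x\<in>V. \<forall>y\<in>V. T (x + y) = T x + T y) \<and> (\<forall>a. \<forall>x\<in>V. T (a *\<^sub>R x) = a *\<^sub>R T x)"

definition endomorphism_field ::
  "('a, 'e::euclidean_space) charted_space \<Rightarrow> 'a endo_field \<Rightarrow> bool" where
  "endomorphism_field M \<phi> \<longleftrightarrow>
     (\<forall>p\<in>points M. linear_map_on (tangent_space M p) (\<phi> p) \<and>
        \<phi> p ` tangent_space M p \<subseteq> tangent_space M p) \<and>
     (\<forall>X\<in>vector_fields M. (\<lambda>p. \<phi> p (X p)) \<in> vector_fields M)"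

definition one_form :: "('a, 'e::euclidean_space) charted_space \<Rightarrow> 'a form_field \<Rightarrow> bool" where
  "one_form M \<eta> \<longleftrightarrow>
     (\<forall>p\<in>points M. linear_map_on (tangent_space M p) (\<eta> p)) \<and>
     (\<forall>X\<in>vector_fields M. (\<lambda>p. \<eta> p (X p)) \<in> smooth_functions M)"

text \<open>\<open>b\<close> has signature \<open>(r, s)\<close> on \<open>V\<close>: there is an orthonormal basis of \<open>V\<close> with \<open>r\<close> vectors of
  square \<open>1\<close> and \<open>s\<close> vectors of square \<open>-1\<close>.  Such a family is automatically linearly
  independent, and \<open>b\<close> is then nondegenerate.\<close>

definition has_signature ::
  "'v::real_vector set \<Rightarrow> ('v \<Rightarrow> 'v \<Rightarrow> real) \<Rightarrow> nat \<Rightarrow> nat \<Rightarrow> bool" where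
  "has_signature V b r s \<longleftrightarrow> (\<exists>e :: nat \<Rightarrow> 'v.
     (\<forall>i<r + s. e i \<in> V) \<and> span (e ` {..<r + s}) = V \<and>
     (\<forall>i<r + s. \<forall>j<r + s. b (e i) (e j) = (if i \<noteq> j then 0 else if i < r then 1 else - 1)))"

definition pseudo_riemannian_metric ::
  "('a, 'e::euclidean_space) charted_space \<Rightarrow> 'a bilinear_field \<Rightarrow> nat \<Rightarrow> nat \<Rightarrow> bool" where
  "pseudo_riemannian_metric M g r s \<longleftrightarrow>
     (\<forall>p\<in>points M.
        (\<forall>x\<in>tangent_space M p. linear_map_on (tangent_space M p) (g p x)) \<and>
        (\<forall>x\<in>tangent_space M p. \<forall>y\<in>tangent_space M p. g p x y = g p y x) \<and>
        has_signature (tangent_space M p) (g p) r s) \<and>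
     (\<forall>X\<in>vector_fields M. \<forall>Y\<in>vector_fields M. (\<lambda>p. g p (X p) (Y p)) \<in> smooth_functions M)"

section \<open>Levi-Civita connection, curvature, Lie derivative\<close>

definition lie_bracket :: "'a vfield \<Rightarrow> 'a vfield \<Rightarrow> 'a vfield" where
  "lie_bracket X Y = (\<lambda>p f. X p (\<lambda>q. Y q f) - Y p (\<lambda>q. X q f))"

definition affine_connection ::
  "('a, 'e::euclidean_space) charted_space \<Rightarrow> 'a connection \<Rightarrow> bool" where
  "affine_connection M nabla \<longleftrightarrow>
     (\<forall>X\<in>vector_fields M. \<forall>Y\<in>vector_fields M. nabla X Y \<in> vector_fields M) \<and>
     (\<forall>X\<in>vector_fields M. \<forall>Y\<in>vector_fields M. \<forall>Z\<in>vector_fields M. \<forall>p\<in>points M.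
        nabla (X + Y) Z p = nabla X Z p + nabla Y Z p \<and>
        nabla X (Y + Z) p = nabla X Y p + nabla X Z p) \<and>
     (\<forall>f\<in>smooth_functions M. \<forall>X\<in>vector_fields M. \<forall>Y\<in>vector_fields M. \<forall>p\<in>points M.
        nabla (\<lambda>q. f q *\<^sub>R X q) Y p = f p *\<^sub>R nabla X Y p \<and>
        nabla X (\<lambda>q. f q *\<^sub>R Y q) p = X p f *\<^sub>R Y p + f p *\<^sub>R nabla X Y p)"

definition levi_civita_connection ::
  "('a, 'e::euclidean_space) charted_space \<Rightarrow> 'a bilinear_field \<Rightarrow> 'a connection \<Rightarrow> bool" where
  "levi_civita_connection M g nabla \<longleftrightarrow>
     affine_connection M nabla \<and>
     (\<forall>X\<in>vector_fields M. \<forall>Y\<in>vector_fields M. \<forall>p\<in>points M.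
        nabla X Y p - nabla Y X p = lie_bracket X Y p) \<and>
     (\<forall>X\<in>vector_fields M. \<forall>Y\<in>vector_fields M. \<forall>Z\<in>vector_fields M. \<forall>p\<in>points M.
        X p (\<lambda>q. g q (Y q) (Z q)) = g p (nabla X Y p) (Z p) + g p (Y p) (nabla X Z p))"

definition curvature :: "'a connection \<Rightarrow> 'a vfield \<Rightarrow> 'a vfield \<Rightarrow> 'a vfield \<Rightarrow> 'a vfield" where
  "curvature nabla X Y Z =
     nabla X (nabla Y Z) - nabla Y (nabla X Z) - nabla (lie_bracket X Y) Z"

definition orthonormal_at ::
  "('a, 'e::euclidean_space) charted_space \<Rightarrow> 'a bilinear_field \<Rightarrow> 'a \<Rightarrow> (nat \<Rightarrow> 'a vfield) \<Rightarrow> bool" where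
  "orthonormal_at M g p E \<longleftrightarrow>
     (\<forall>i<DIM('e). E i \<in> vector_fields M) \<and>
     span ((\<lambda>i. E i p) ` {..<DIM('e)}) = tangent_space M p \<and>
     (\<forall>i<DIM('e). \<forall>j<DIM('e). i \<noteq> j \<longrightarrow> g p (E i p) (E j p) = 0) \<and>
     (\<forall>i<DIM('e). \<bar>g p (E i p) (E i p)\<bar> = 1)"

text \<open>\<open>Ric(Y, Z) = trace (x \<mapsto> R(x, Y) Z)\<close> and \<open>\<tau> = trace\<^sub>g Ric\<close>, both traces being evaluated at \<open>p\<close>
  in vector fields that form an orthonormal basis at \<open>p\<close>, with signs \<open>g(E\<^sub>i, E\<^sub>i) = \<plusminus>1\<close>.
  The values do not depend on the basis and its extension, since the curvature is tensorial.\<close>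

definition ricci ::
  "('a, 'e::euclidean_space) charted_space \<Rightarrow> 'a bilinear_field \<Rightarrow> 'a connection
     \<Rightarrow> 'a vfield \<Rightarrow> 'a vfield \<Rightarrow> 'a \<Rightarrow> real" where
  "ricci M g nabla Y Z p = (let E = (SOME E. orthonormal_at M g p E) in
     \<Sum>i<DIM('e). g p (E i p) (E i p) * g p (curvature nabla (E i) Y Z p) (E i p))"

definition scalar_curvature ::
  "('a, 'e::euclidean_space) charted_space \<Rightarrow> 'a bilinear_field \<Rightarrow> 'a connection \<Rightarrow> 'a \<Rightarrow> real" where
  "scalar_curvature M g nabla p = (let E = (SOME E. orthonormal_at M g p E) in
     \<Sum>i<DIM('e). g p (E i p) (E i p) * ricci M g nabla (E i) (E i) p)"

definition lie_derivative ::
  "'a vfield \<Rightarrow> 'a bilinear_field \<Rightarrow> 'a vfield \<Rightarrow> 'a vfield \<Rightarrow> 'a \<Rightarrow> real" where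
  "lie_derivative \<theta> g X Y p = \<theta> p (\<lambda>q. g q (X q) (Y q))
     - g p (lie_bracket \<theta> X p) (Y p) - g p (X p) (lie_bracket \<theta> Y p)"

section \<open>Almost contact complex Riemannian manifolds and Yamabe almost solitons\<close>

definition accR_manifold ::
  "('a, 'e::euclidean_space) charted_space \<Rightarrow> nat \<Rightarrow> 'a endo_field \<Rightarrow> 'a vfield \<Rightarrow> 'a form_field
     \<Rightarrow> 'a bilinear_field \<Rightarrow> bool" where
  "accR_manifold M n \<phi> \<xi> \<eta> g \<longleftrightarrow>
     smooth_manifold M \<and> n \<ge> 1 \<and> DIM('e) = 2 * n + 1 \<and>
     endomorphism_field M \<phi> \<and> \<xi> \<in> vector_fields M \<and> one_form M \<eta> \<and>
     pseudo_riemannian_metric M g (n + 1) n \<and>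
     (\<forall>p\<in>points M. \<phi> p (\<xi> p) = 0 \<and> \<eta> p (\<xi> p) = 1 \<and>
        (\<forall>x\<in>tangent_space M p.
           \<phi> p (\<phi> p x) = - x + \<eta> p x *\<^sub>R \<xi> p \<and> \<eta> p (\<phi> p x) = 0 \<and>
           (\<forall>y\<in>tangent_space M p. g p (\<phi> p x) (\<phi> p y) = - g p x y + \<eta> p x * \<eta> p y)))"

definition covariant_derivative_endo ::
  "'a connection \<Rightarrow> 'a endo_field \<Rightarrow> 'a vfield \<Rightarrow> 'a vfield \<Rightarrow> 'a vfield" where
  "covariant_derivative_endo nabla \<phi> X Y =
     (\<lambda>p. nabla X (\<lambda>q. \<phi> q (Y q)) p - \<phi> p (nabla X Y p))"

definition sasaki_like ::
  "('a, 'e::euclidean_space) charted_space \<Rightarrow> 'a endo_field \<Rightarrow> 'a vfield \<Rightarrow> 'a form_field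
     \<Rightarrow> 'a bilinear_field \<Rightarrow> 'a connection \<Rightarrow> bool" where
  "sasaki_like M \<phi> \<xi> \<eta> g nabla \<longleftrightarrow>
     (\<forall>X\<in>vector_fields M. \<forall>Y\<in>vector_fields M. \<forall>p\<in>points M.
        covariant_derivative_endo nabla \<phi> X Y p =
          \<eta> p (Y p) *\<^sub>R \<phi> p (\<phi> p (X p)) + g p (\<phi> p (X p)) (\<phi> p (Y p)) *\<^sub>R \<xi> p)"

text \<open>In the remaining definitions \<open>nabla\<close> is the Levi-Civita connection of \<open>g\<close>.\<close>

definition yamabe_almost_soliton ::
  "('a, 'e::euclidean_space) charted_space \<Rightarrow> 'a bilinear_field \<Rightarrow> 'a connection
     \<Rightarrow> 'a vfield \<Rightarrow> ('a \<Rightarrow> real) \<Rightarrow> bool" where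
  "yamabe_almost_soliton M g nabla \<theta> l \<longleftrightarrow>
     \<theta> \<in> vector_fields M \<and> l \<in> smooth_functions M \<and>
     (\<forall>X\<in>vector_fields M. \<forall>Y\<in>vector_fields M. \<forall>p\<in>points M.
        1 / 2 * lie_derivative \<theta> g X Y p = (scalar_curvature M g nabla p - l p) * g p (X p) (Y p))"

definition vertical_potential ::
  "('a, 'e::euclidean_space) charted_space \<Rightarrow> 'a vfield \<Rightarrow> 'a vfield \<Rightarrow> bool" where
  "vertical_potential M \<xi> \<theta> \<longleftrightarrow>
     (\<exists>k\<in>smooth_functions M. (\<forall>p\<in>points M. k p \<noteq> 0) \<and> (\<forall>p\<in>points M. \<theta> p = k p *\<^sub>R \<xi> p))"

end

theory Submission
  imports Defs
begin

text \<open>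
  On a Sasaki-like manifold \<open>\<nabla>\<^sub>X \<xi> = - \<phi> X\<close>, and \<open>\<phi>\<close> is self-adjoint for \<open>g\<close>.  So on the contact
  distribution (the kernel of \<open>\<eta>\<close>) half the Lie derivative of \<open>g\<close> along \<open>\<theta> = k \<xi>\<close> is
  \<open>- k g(\<phi> X, Y)\<close>: the terms containing \<open>dk\<close> disappear, each having a factor \<open>\<eta>\<close>.  A soliton makes
  this equal to \<open>c g(X, Y)\<close>, with \<open>c = \<tau> - \<lambda>\<close> at the point.  If \<open>k \<noteq> 0\<close>, then \<open>\<phi>\<close> is the real
  multiple \<open>- c / k\<close> of the identity on the contact distribution, although \<open>\<phi>\<^sup>2 = - Id\<close> there: a
  contradiction, since \<open>(c / k)\<^sup>2 = -1\<close> has no real solution.  The contradiction arises at each point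
  where \<open>k\<close> is nonzero: a vertical field cannot be conformal there (\<open>no_vertical_conformal_field\<close>).

  Horizontal fields are written as \<open>\<phi> X\<close> with \<open>X\<close> arbitrary, so that any field yields one.
  \<open>metric_nabla_xi\<close> and \<open>lie_derivative_vertical\<close> carry the geometry, and
  \<open>metric_phi_phi_nonzero\<close> says that \<open>g\<close> is not zero on the contact distribution.

  The hypotheses speak of global vector fields, while the contradiction lies in a single tangent
  space.  The bridge is \<open>tangent_vector_extends\<close>: every tangent vector is the value of a smooth vector
  field.  The coordinate fields of a chart, cut off by a bump function, give \<open>DIM('e)\<close> linearly
  independent values at the point, and the signature of \<open>g\<close> bounds the dimension of the tangent space
  by the same number; hence these values exhaust the tangent space.  The bump function and its calculus
  are built on the recursive notion \<open>Ck_on\<close> of differentiability.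
\<close>

section \<open>Calculus of \<open>k\<close> times continuously differentiable maps\<close>

lemma Ck_on_cong:
  fixes f :: "'e::euclidean_space \<Rightarrow> 'b::real_normed_vector"
  assumes "open S" and "\<And>x. x \<in> S \<Longrightarrow> f x = h x" and "Ck_on k S f"
  shows "Ck_on k S h"
  using assms(2,3)
proof (induction k arbitrary: f h)
  case 0
  then show ?case by (metis Ck_on.simps(1) continuous_on_cong)
next
  case (Suc k)
  have der: "(h has_derivative frechet_derivative f (at x)) (at x)" if x: "x \<in> S" for x
  proof -
    have "(f has_derivative frechet_derivative f (at x)) (at x)"
      using Suc.prems(2) x by (auto simp: frechet_derivative_works)
    then show ?thesis
      using has_derivative_transform_within_open[OF _ \<open>open S\<close> x] Suc.prems(1) by blast
  qed
  have "Ck_on k S (\<lambda>x. frechet_derivative h (at x) v)" for v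
  proof (rule Suc.IH)
    show "frechet_derivative f (at x) v = frechet_derivative h (at x) v" if "x \<in> S" for x
      using frechet_derivative_at[OF der[OF that]] by simp
    show "Ck_on k S (\<lambda>x. frechet_derivative f (at x) v)"
      using Suc.prems(2) by simp
  qed
  moreover have "h differentiable (at x)" if "x \<in> S" for x
    using der[OF that] differentiable_def by blast
  ultimately show ?case by simp
qed

lemma Ck_on_SucI:
  assumes "open S" and der: "\<And>x. x \<in> S \<Longrightarrow> (f has_derivative F x) (at x)"
    and Ck: "\<And>v. Ck_on k S (\<lambda>x. F x v)"
  shows "Ck_on (Suc k) S f"
proof -
  have "frechet_derivative f (at x) = F x" if "x \<in> S" for x
    using der[OF that] by (metis frechet_derivative_at)
  then have "Ck_on k S (\<lambda>x. frechet_derivative f (at x) v)" for v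
    by (intro Ck_on_cong[OF \<open>open S\<close> _ Ck[of v]]) simp
  moreover have "f differentiable (at x)" if "x \<in> S" for x
    using der[OF that] differentiable_def by blast
  ultimately show ?thesis by simp
qed

lemma Ck_on_SucD:
  assumes "Ck_on (Suc k) S f"
  shows "x \<in> S \<Longrightarrow> (f has_derivative frechet_derivative f (at x)) (at x)"
    and "Ck_on k S (\<lambda>x. frechet_derivative f (at x) v)"
  using assms by (auto simp: frechet_derivative_works)

text \<open>Smoothness near every point suffices.  This is what permits functions on a manifold to be glued
  from a part inside a chart and a zero part outside.\<close>

lemma Ck_on_local:
  fixes f :: "'e::euclidean_space \<Rightarrow> 'b::real_normed_vector"
  assumes "\<And>x. x \<in> S \<Longrightarrow> \<exists>T. open T \<and> x \<in> T \<and> Ck_on k T f"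
  shows "Ck_on k S f"
  using assms
proof (induction k arbitrary: f)
  case 0
  then have "isCont f x" if "x \<in> S" for x
    using that by (metis Ck_on.simps(1) continuous_on_eq_continuous_at)
  then show ?case by (simp add: continuous_at_imp_continuous_on)
next
  case (Suc k)
  have "f differentiable (at x)" if "x \<in> S" for x
    using Suc.prems[OF that] by auto
  moreover have "Ck_on k S (\<lambda>x. frechet_derivative f (at x) v)" for v
    by (rule Suc.IH) (use Suc.prems in fastforce)
  ultimately show ?case by simp
qed

lemma Ck_on_decrease:
  fixes f :: "'e::euclidean_space \<Rightarrow> 'b::real_normed_vector"
  assumes "Ck_on (Suc k) S f"
  shows "Ck_on k S f"
  using assms
proof (induction k arbitrary: f)
  case 0
  then have "f differentiable (at x)" if "x \<in> S" for x
    using that by auto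
  then show ?case
    by (simp add: continuous_at_imp_continuous_on differentiable_imp_continuous_within)
next
  case (Suc k)
  from Suc.prems have "\<forall>x\<in>S. f differentiable (at x)"
    and "\<And>v. Ck_on (Suc k) S (\<lambda>x. frechet_derivative f (at x) v)"
    by (auto simp del: Ck_on.simps(2) simp: Ck_on.simps(2)[of "Suc k"])
  with Suc.IH show ?case
    by (simp only: Ck_on.simps(2)[of k S f]) blast
qed

lemma Ck_on_const: "open S \<Longrightarrow> Ck_on k S (\<lambda>x. a)"
  by (induction k arbitrary: a)
    (auto intro!: Ck_on_SucI[where F = "\<lambda>x v. 0"] simp del: Ck_on.simps(2))

lemma Ck_on_add:
  fixes f :: "'e::euclidean_space \<Rightarrow> 'b::real_normed_vector"
  assumes "open S" "Ck_on k S f" "Ck_on k S h"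
  shows "Ck_on k S (\<lambda>x. f x + h x)"
  using assms(2,3)
proof (induction k arbitrary: f h)
  case 0
  then show ?case by (simp add: continuous_on_add)
next
  case (Suc k)
  show ?case
  proof (rule Ck_on_SucI[OF \<open>open S\<close>])
    show "((\<lambda>x. f x + h x) has_derivative
        (\<lambda>v. frechet_derivative f (at x) v + frechet_derivative h (at x) v)) (at x)"
      if "x \<in> S" for x
      using that Suc.prems by (intro has_derivative_add Ck_on_SucD(1))
  qed (use Suc in auto)
qed

lemma Ck_on_sum:
  assumes "open S" "\<And>i. i \<in> I \<Longrightarrow> Ck_on k S (f i)"
  shows "Ck_on k S (\<lambda>x. \<Sum>i\<in>I. f i x)"
  using assms(2)
  by (induction I rule: infinite_finite_induct)
    (auto intro: Ck_on_const Ck_on_add \<open>open S\<close>)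

lemma Ck_on_bounded_bilinear:
  fixes f :: "'e::euclidean_space \<Rightarrow> 'b::real_normed_vector"
    and h :: "'e \<Rightarrow> 'c::real_normed_vector" and prod :: "'b \<Rightarrow> 'c \<Rightarrow> 'd::real_normed_vector"
  assumes "bounded_bilinear prod" "open S" "Ck_on k S f" "Ck_on k S h"
  shows "Ck_on k S (\<lambda>x. prod (f x) (h x))"
  using assms(3,4)
proof (induction k arbitrary: f h)
  case 0
  then show ?case by (simp add: bounded_bilinear.continuous_on[OF assms(1)])
next
  case (Suc k)
  show ?case
  proof (rule Ck_on_SucI[OF \<open>open S\<close>])
    show "((\<lambda>x. prod (f x) (h x)) has_derivative
        (\<lambda>v. prod (f x) (frechet_derivative h (at x) v) + prod (frechet_derivative f (at x) v) (h x)))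
        (at x)" if "x \<in> S" for x
      using that Suc.prems by (intro bounded_bilinear.FDERIV[OF assms(1)] Ck_on_SucD(1))
    show "Ck_on k S (\<lambda>x. prod (f x) (frechet_derivative h (at x) v)
        + prod (frechet_derivative f (at x) v) (h x))" for v
      using Suc.prems
      by (intro Ck_on_add \<open>open S\<close> Suc.IH Ck_on_SucD(2)) (auto intro: Ck_on_decrease)
  qed
qed

lemmas Ck_on_mult = Ck_on_bounded_bilinear[OF bounded_bilinear_mult]
lemmas Ck_on_inner = Ck_on_bounded_bilinear[OF bounded_bilinear_inner]

lemma Ck_on_id: "open S \<Longrightarrow> Ck_on k S (\<lambda>x. x)"
proof (cases k)
  case (Suc j)
  assume "open S"
  then show ?thesis
    unfolding Suc by (intro Ck_on_SucI[where F = "\<lambda>x v. v"]) (auto intro: Ck_on_const)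
qed auto

lemma Ck_on_compose:
  fixes f :: "'f::euclidean_space \<Rightarrow> 'b::real_normed_vector" and h :: "'e::euclidean_space \<Rightarrow> 'f"
  assumes "open S" "open T" "h ` S \<subseteq> T" "Ck_on k T f" "Ck_on k S h"
  shows "Ck_on k S (\<lambda>x. f (h x))"
  using assms(4,5)
proof (induction k arbitrary: f)
  case 0
  then show ?case
    using \<open>h ` S \<subseteq> T\<close> by (auto intro: continuous_on_compose2)
next
  case (Suc k)
  \<comment> \<open>Expanding the inner derivative in the basis makes the chain rule a finite sum of products of
    maps to which the induction hypothesis applies.\<close>
  let ?D = "\<lambda>x v. \<Sum>i\<in>Basis. (frechet_derivative h (at x) v \<bullet> i) *\<^sub>R frechet_derivative f (at (h x)) i"
  show ?case
  proof (rule Ck_on_SucI[OF \<open>open S\<close>])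
    fix x assume x: "x \<in> S"
    have f': "(f has_derivative frechet_derivative f (at (h x))) (at (h x))"
      using Suc.prems(1) x \<open>h ` S \<subseteq> T\<close> by (intro Ck_on_SucD(1)) auto
    have h': "(h has_derivative frechet_derivative h (at x)) (at x)"
      using Suc.prems(2) x by (rule Ck_on_SucD(1))
    have lin: "linear (frechet_derivative f (at (h x)))"
      using f' has_derivative_linear by blast
    have "frechet_derivative f (at (h x)) (frechet_derivative h (at x) v) = ?D x v" for v
      using arg_cong[OF euclidean_representation, of "frechet_derivative f (at (h x))"
          "frechet_derivative h (at x) v"]
      by (simp add: linear_sum[OF lin] linear_scale[OF lin])
    then show "((\<lambda>x. f (h x)) has_derivative ?D x) (at x)"
      using has_derivative_compose[OF h' f'] by presburger
  next
    fix v
    have "Ck_on k S (\<lambda>x. frechet_derivative f (at (h x)) i)" for i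
      using Suc.IH[OF Ck_on_SucD(2)[OF Suc.prems(1)] Ck_on_decrease[OF Suc.prems(2)]] .
    then show "Ck_on k S (\<lambda>x. ?D x v)"
      by (intro Ck_on_sum Ck_on_bounded_bilinear[OF bounded_bilinear_scaleR] Ck_on_inner
          Ck_on_const Ck_on_SucD(2)[OF Suc.prems(2)] \<open>open S\<close>)
  qed
qed

section \<open>A smooth bump function\<close>

text \<open>\<open>flat 0\<close> is the classical function \<open>exp (- 1 / t)\<close>, extended by \<open>0\<close>, which vanishes to
  infinite order at \<open>0\<close>.  The extra powers of \<open>1 / t\<close> make the family closed, up to linear combinations, under differentiation,
  so that smoothness of all its members follows by one induction.\<close>

definition flat :: "nat \<Rightarrow> real \<Rightarrow> real" where
  "flat j t = (if t > 0 then inverse t ^ j * exp (- inverse t) else 0)"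

lemma flat_tendsto_0: "(flat j \<longlongrightarrow> 0) (at 0)"
proof (rule filterlim_split_at)
  show "(flat j \<longlongrightarrow> 0) (at_left 0)"
    by (rule tendsto_eventually) (auto simp: flat_def eventually_at_filter)
  have "((\<lambda>t. inverse t ^ j / exp (inverse t)) \<longlongrightarrow> 0) (at_right (0::real))"
    by (rule filterlim_compose[OF tendsto_power_div_exp_0 filterlim_inverse_at_top_right])
  then show "(flat j \<longlongrightarrow> 0) (at_right 0)"
    by (rule Lim_transform_eventually)
      (auto simp: flat_def eventually_at_filter exp_minus divide_inverse)
qed

text \<open>At \<open>0\<close> the difference quotient of \<open>flat j\<close> is \<open>flat (j + 1)\<close> itself, which tends to \<open>0\<close>.\<close>

lemma flat_has_derivative:
  "(flat j has_real_derivative flat (j + 2) t - real j * flat (j + 1) t) (at t)"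
proof -
  consider "t < 0" | "t = 0" | "t > 0" by linarith
  then show ?thesis
  proof cases
    case 1
    have "((\<lambda>t. 0) has_real_derivative 0) (at t)" by simp
    then have "(flat j has_real_derivative 0) (at t)"
      by (rule has_field_derivative_transform_within_open[of _ _ _ "{..<0}"])
        (use 1 in \<open>auto simp: flat_def\<close>)
    then show ?thesis using 1 by (simp add: flat_def)
  next
    case 2
    have "(\<lambda>h. (flat j (0 + h) - flat j 0) / h) = flat (Suc j)"
      by (auto simp: flat_def fun_eq_iff field_simps)
    then show ?thesis
      using flat_tendsto_0[of "Suc j"] 2 by (simp add: DERIV_def flat_def)
  next
    case 3
    have pow: "((\<lambda>t. inverse t ^ j) has_real_derivative - real j * inverse t ^ (j + 1)) (at t)"
    proof (cases j)
      case (Suc i)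
      then show ?thesis
        using 3 unfolding Suc
        by (intro DERIV_cong[OF DERIV_power[OF DERIV_inverse]])
          (auto simp: algebra_simps power2_eq_square)
    qed simp
    have "((\<lambda>t. inverse t ^ j * exp (- inverse t)) has_real_derivative
        inverse t ^ (j + 2) * exp (- inverse t) - real j * (inverse t ^ (j + 1) * exp (- inverse t)))
        (at t)"
      by (rule DERIV_cong[OF DERIV_mult[OF pow DERIV_fun_exp[OF DERIV_minus[OF DERIV_inverse]]]])
        (use 3 in \<open>auto simp: algebra_simps power2_eq_square\<close>)
    then have "(flat j has_real_derivative
        inverse t ^ (j + 2) * exp (- inverse t) - real j * (inverse t ^ (j + 1) * exp (- inverse t)))
        (at t)"
      by (rule has_field_derivative_transform_within_open[of _ _ _ "{0<..}"])
        (use 3 in \<open>auto simp: flat_def\<close>)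
    then show ?thesis using 3 by (simp add: flat_def)
  qed
qed

lemma Ck_on_flat: "Ck_on k UNIV (flat j)"
proof (induction k arbitrary: j)
  case 0
  have "isCont (flat j) t" for t
    using flat_has_derivative DERIV_isCont by blast
  then show ?case by (simp add: continuous_at_imp_continuous_on)
next
  case (Suc k)
  show ?case
  proof (rule Ck_on_SucI)
    show "(flat j has_derivative
        (\<lambda>v. (flat (j + 2) t + (- real j) * flat (j + 1) t) * v)) (at t)" for t
      using flat_has_derivative[of j t] by (simp add: has_field_derivative_def)
    show "Ck_on k UNIV (\<lambda>t. (flat (j + 2) t + (- real j) * flat (j + 1) t) * v)" for v
      by (intro Ck_on_mult Ck_on_add Ck_on_const Suc.IH) auto
  qed auto
qed

text \<open>The squared distance to \<open>y0\<close> is used because, unlike the distance, it is smooth at \<open>y0\<close>.\<close>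

definition bump :: "'e::euclidean_space \<Rightarrow> real \<Rightarrow> 'e \<Rightarrow> real" where
  "bump y0 r y = flat 0 (r\<^sup>2 - (y - y0) \<bullet> (y - y0))"

lemma Ck_on_bump: "open S \<Longrightarrow> Ck_on k S (bump y0 r)"
proof -
  assume S: "open S"
  have "Ck_on k S (\<lambda>y. r\<^sup>2 + (- 1) * ((y + - y0) \<bullet> (y + - y0)))"
    by (intro Ck_on_add Ck_on_mult Ck_on_inner Ck_on_const Ck_on_id S)
  from Ck_on_compose[OF S open_UNIV subset_UNIV Ck_on_flat this, of 0] show ?thesis
    by (simp add: bump_def[abs_def])
qed

lemma bump_outside_cball:
  assumes "r > 0" and "y \<notin> cball y0 r"
  shows "bump y0 r y = 0"
proof -
  have "r < norm (y - y0)"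
    using assms(2) by (simp add: dist_norm norm_minus_commute)
  then have "r\<^sup>2 \<le> (norm (y - y0))\<^sup>2"
    using assms(1) by (intro power_mono) auto
  then show ?thesis
    by (simp add: bump_def flat_def dot_square_norm)
qed

lemma bump_center: "r > 0 \<Longrightarrow> bump y0 r y0 \<noteq> 0"
  by (simp add: bump_def flat_def)

section \<open>Extending tangent vectors to vector fields\<close>

lemma chart_facts:
  assumes "smooth_manifold M" and "(U, c) \<in> atlas M"
  shows chart_open: "openin (top_of M) U"
    and chart_subset: "U \<subseteq> points M"
    and chart_open_image: "open (c ` U)"
    and chart_homeomorphic: "homeomorphic_map (subtopology (top_of M) U) (top_of_set (c ` U)) c"
    and chart_inj: "inj_on c U"
proof -
  show 1: "openin (top_of M) U" and "open (c ` U)"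
    and 2: "homeomorphic_map (subtopology (top_of M) U) (top_of_set (c ` U)) c"
    using assms unfolding smooth_manifold_def by blast+
  show 3: "U \<subseteq> points M"
    using openin_subset[OF 1] by (simp add: points_def)
  show "inj_on c U"
    using homeomorphic_imp_injective_map[OF 2] 3
    by (simp add: points_def inf_absorb2)
qed

lemma chart_transition:
  assumes "smooth_manifold M" and "(U, c) \<in> atlas M" and "(V, d) \<in> atlas M"
  shows "smooth_on (c ` (U \<inter> V)) (d \<circ> inv_into U c)"
proof -
  have "\<forall>(U, c)\<in>atlas M. \<forall>(V, d)\<in>atlas M. smooth_on (c ` (U \<inter> V)) (d \<circ> inv_into U c)"
    using assms(1) by (simp add: smooth_manifold_def)
  then show ?thesis
    using assms(2,3) by fast
qed

lemma chart_image_open: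
  assumes "smooth_manifold M" and "(U, c) \<in> atlas M" and "openin (top_of M) W"
  shows "open (c ` (U \<inter> W))"
proof -
  have "openin (subtopology (top_of M) U) (U \<inter> W)"
    using assms(3) by (auto simp: openin_subtopology)
  then have "openin (top_of_set (c ` U)) (c ` (U \<inter> W))"
    using homeomorphic_imp_open_map[OF chart_homeomorphic[OF assms(1,2)]]
    by (simp add: open_map_def)
  then show ?thesis
    using chart_open_image[OF assms(1,2)] openin_open_trans by blast
qed

text \<open>Here the Hausdorff property enters: a compact set is closed in the whole manifold and not only in
  the chart domain.\<close>

lemma chart_preimage_compact_closed:
  assumes "smooth_manifold M" and "(U, c) \<in> atlas M" and "compact K" and "K \<subseteq> c ` U"
  shows "closedin (top_of M) (inv_into U c ` K)"
proof -
  note U = chart_subset[OF assms(1,2)] and c = chart_homeomorphic[OF assms(1,2)]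
  obtain d where d: "homeomorphic_maps (subtopology (top_of M) U) (top_of_set (c ` U)) c d"
    using c homeomorphic_map_maps by blast
  have "d y = inv_into U c y" if "y \<in> K" for y
  proof -
    obtain q where q: "q \<in> U" "y = c q" using \<open>K \<subseteq> c ` U\<close> \<open>y \<in> K\<close> by blast
    have "q \<in> topspace (subtopology (top_of M) U)"
      using q U by (auto simp: points_def)
    then have "d (c q) = q"
      using d by (simp add: homeomorphic_maps_def)
    then show ?thesis using q chart_inj[OF assms(1,2)] by simp
  qed
  then have img: "inv_into U c ` K = d ` K" by simp
  have "continuous_map (top_of_set (c ` U)) (subtopology (top_of M) U) d"
    using d by (simp add: homeomorphic_maps_def)
  moreover have "compactin (top_of_set (c ` U)) K"
    using assms(3,4) by (simp add: compactin_subtopology)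
  ultimately have "compactin (subtopology (top_of M) U) (d ` K)"
    using image_compactin by blast
  then have "compactin (top_of M) (d ` K)"
    by (simp add: compactin_subtopology)
  then show ?thesis
    unfolding img using assms(1) by (simp add: compactin_imp_closedin smooth_manifold_def)
qed

text \<open>In another chart, the extension is a composite with the transition map on the overlap with \<open>U\<close>;
  any point outside \<open>U\<close> has the complement of the preimage of \<open>K\<close> as an open neighbourhood, where the
  extension is zero.  Without a compact \<open>K\<close> the extension could fail to be continuous at the boundary
  of \<open>U\<close>.\<close>

lemma smooth_functions_extend_by_zero:
  assumes M: "smooth_manifold M" and U: "(U, c) \<in> atlas M" and H: "smooth_on (c ` U) H"
    and K: "compact K" "K \<subseteq> c ` U" and zero: "\<And>y. y \<in> c ` U - K \<Longrightarrow> H y = 0"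
  shows "(\<lambda>q. if q \<in> U then H (c q) else 0) \<in> smooth_functions M"
proof -
  let ?h = "\<lambda>q. if q \<in> U then H (c q) else 0"
  let ?L = "inv_into U c ` K"
  have "smooth_on (d ` V) (?h \<circ> inv_into V d)" if V: "(V, d) \<in> atlas M" for V d
    unfolding smooth_on_def
  proof (intro allI Ck_on_local)
    fix k y assume "y \<in> d ` V"
    then obtain q where q: "q \<in> V" "y = d q" by blast
    note injU = chart_inj[OF M U] and injV = chart_inj[OF M V]
    show "\<exists>T. open T \<and> y \<in> T \<and> Ck_on k T (?h \<circ> inv_into V d)"
    proof (cases "q \<in> U")
      case True
      let ?T = "d ` (V \<inter> U)"
      have T: "open ?T" by (rule chart_image_open[OF M V chart_open[OF M U]])
      have "smooth_on ?T (c \<circ> inv_into V d)"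
        by (rule chart_transition[OF M V U])
      then have "Ck_on k ?T (\<lambda>x. H ((c \<circ> inv_into V d) x))"
        unfolding smooth_on_def
        by (intro Ck_on_compose[OF T chart_open_image[OF M U], where f = H and k = k]
            H[unfolded smooth_on_def, rule_format]) (use injV in \<open>auto simp: o_def\<close>)
      then have "Ck_on k ?T (?h \<circ> inv_into V d)"
        by (rule Ck_on_cong[OF T, rotated]) (use injV in auto)
      then show ?thesis using T q True by blast
    next
      case False
      let ?T = "d ` (V \<inter> (points M - ?L))"
      have "openin (top_of M) (points M - ?L)"
        using chart_preimage_compact_closed[OF M U K] by (simp add: points_def openin_diff)
      then have T: "open ?T" by (rule chart_image_open[OF M V])
      have "(?h \<circ> inv_into V d) x = 0" if "x \<in> ?T" for x
        using that injV injU zero by (auto simp: image_iff)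
          (metis DiffI image_eqI inv_into_f_f)
      then have "Ck_on k ?T (?h \<circ> inv_into V d)"
        by (intro Ck_on_cong[OF T _ Ck_on_const[OF T, of k 0]]) (rule sym)
      moreover have "?L \<subseteq> U"
        using K(2) by (auto intro: inv_into_into)
      then have "q \<notin> ?L"
        using False by blast
      ultimately show ?thesis
        using T q chart_subset[OF M V] by blast
    qed
  qed
  then show ?thesis by (auto simp: smooth_functions_def)
qed

lemma smooth_functions_in_chart:
  assumes "f \<in> smooth_functions M" and "(U, c) \<in> atlas M"
  shows "Ck_on k (c ` U) (f \<circ> inv_into U c)"
  using assms by (auto simp: smooth_functions_def smooth_on_def)

lemma smooth_functions_arithmetic:
  assumes M: "smooth_manifold M" and f: "f \<in> smooth_functions M" and h: "h \<in> smooth_functions M"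
  shows "f + h \<in> smooth_functions M" and "f * h \<in> smooth_functions M"
    and "a *\<^sub>R f \<in> smooth_functions M"
proof -
  have *: "(f + h) \<circ> d = (\<lambda>x. (f \<circ> d) x + (h \<circ> d) x)" "(f * h) \<circ> d = (\<lambda>x. (f \<circ> d) x * (h \<circ> d) x)"
    "(a *\<^sub>R f) \<circ> d = (\<lambda>x. a * (f \<circ> d) x)" for d :: "'b \<Rightarrow> 'a"
    by (auto simp: scaleR_fun_def)
  show "f + h \<in> smooth_functions M" "f * h \<in> smooth_functions M" "a *\<^sub>R f \<in> smooth_functions M"
    unfolding smooth_functions_def smooth_on_def
    by (auto simp only: mem_Collect_eq * intro!: Ck_on_add Ck_on_mult Ck_on_const
        chart_open_image[OF M] smooth_functions_in_chart[OF f] smooth_functions_in_chart[OF h])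
qed

text \<open>In the chart \<open>(U, c)\<close> this is the constant field \<open>v\<close> multiplied by \<open>b\<close>; the value \<open>0\<close> on non-smooth
  functions is the convention that tangent vectors obey.\<close>

definition cutoff_field ::
  "('a, 'e::euclidean_space) charted_space \<Rightarrow> 'a set \<Rightarrow> ('a \<Rightarrow> 'e) \<Rightarrow> ('e \<Rightarrow> real) \<Rightarrow> 'e \<Rightarrow> 'a vfield"
  where
  "cutoff_field M U c b v = (\<lambda>q f. if f \<in> smooth_functions M \<and> q \<in> U
     then b (c q) * frechet_derivative (f \<circ> inv_into U c) (at (c q)) v else 0)"

lemma smooth_functions_has_derivative:
  assumes "f \<in> smooth_functions M" and "(U, c) \<in> atlas M" and "y \<in> c ` U"
  shows "((f \<circ> inv_into U c) has_derivative frechet_derivative (f \<circ> inv_into U c) (at y)) (at y)"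
  using Ck_on_SucD(1)[OF smooth_functions_in_chart[OF assms(1,2)] assms(3)] .

lemma cutoff_field_tangent:
  assumes M: "smooth_manifold M" and U: "(U, c) \<in> atlas M"
  shows "cutoff_field M U c b v q \<in> tangent_space M q"
proof (cases "q \<in> U")
  case True
  let ?i = "inv_into U c" and ?D = "\<lambda>f. frechet_derivative (f \<circ> inv_into U c) (at (c q))"
  have inv: "?i (c q) = q" using True chart_inj[OF M U] by simp
  note der = smooth_functions_has_derivative[OF _ U, of _ "c q"]
  have add: "?D (f + h) = (\<lambda>v. ?D f v + ?D h v)"
    and mult: "?D (f * h) = (\<lambda>v. f q * ?D h v + ?D f v * h q)"
    and scale: "?D (a *\<^sub>R f) = (\<lambda>v. a * ?D f v)"
    if f: "f \<in> smooth_functions M" and h: "h \<in> smooth_functions M" for f h a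
  proof -
    have *: "(f + h) \<circ> ?i = (\<lambda>x. (f \<circ> ?i) x + (h \<circ> ?i) x)"
      "(f * h) \<circ> ?i = (\<lambda>x. (f \<circ> ?i) x * (h \<circ> ?i) x)"
      "(a *\<^sub>R f) \<circ> ?i = (\<lambda>x. a * (f \<circ> ?i) x)"
      by (auto simp: scaleR_fun_def)
    note f' = der[OF f imageI[OF True]] and h' = der[OF h imageI[OF True]]
    show "?D (f + h) = (\<lambda>v. ?D f v + ?D h v)"
      unfolding *(1) by (rule frechet_derivative_at[OF has_derivative_add[OF f' h'], symmetric])
    show "?D (f * h) = (\<lambda>v. f q * ?D h v + ?D f v * h q)"
      unfolding *(2) using frechet_derivative_at[OF has_derivative_mult[OF f' h'], symmetric] inv
      by simp
    show "?D (a *\<^sub>R f) = (\<lambda>v. a * ?D f v)"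
      unfolding *(3) by (rule frechet_derivative_at[OF has_derivative_mult_right[OF f'], symmetric])
  qed
  show ?thesis
    unfolding tangent_space_def cutoff_field_def
    using True smooth_functions_arithmetic[OF M]
    by (auto simp: add mult scale[of _ 0] distrib_left algebra_simps)
       (use scale in force)+
next
  case False
  then show ?thesis
    by (auto simp: tangent_space_def cutoff_field_def)
qed

lemma cutoff_field_vector_field:
  assumes M: "smooth_manifold M" and U: "(U, c) \<in> atlas M" and b: "smooth_on (c ` U) b"
    and K: "compact K" "K \<subseteq> c ` U" and zero: "\<And>y. y \<in> c ` U - K \<Longrightarrow> b y = 0"
  shows "cutoff_field M U c b v \<in> vector_fields M"
proof -
  have "(\<lambda>q. cutoff_field M U c b v q f) \<in> smooth_functions M" if f: "f \<in> smooth_functions M" for f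
  proof -
    let ?H = "\<lambda>y. b y * frechet_derivative (f \<circ> inv_into U c) (at y) v"
    have "smooth_on (c ` U) ?H"
      using b unfolding smooth_on_def
      by (auto intro!: Ck_on_mult chart_open_image[OF M U]
          Ck_on_SucD(2)[OF smooth_functions_in_chart[OF f U]])
    then have "(\<lambda>q. if q \<in> U then ?H (c q) else 0) \<in> smooth_functions M"
      by (rule smooth_functions_extend_by_zero[OF M U _ K]) (simp add: zero)
    then show ?thesis using f by (simp add: cutoff_field_def)
  qed
  then show ?thesis
    using cutoff_field_tangent[OF M U] by (auto simp: vector_fields_def)
qed

text \<open>At \<open>p\<close> the cut-off fields define a linear map \<open>v \<mapsto> X\<^sub>v p\<close> from the model space into the tangent
  space.  It is injective, as the coordinate functions, again cut off by the bump function, recover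
  \<open>v\<close>.  A bound on the dimension of the tangent space therefore makes it surjective, and spares the
  determination of all derivations by Hadamard's lemma.\<close>

lemma tangent_vector_extends:
  fixes M :: "('a, 'e::euclidean_space) charted_space"
  assumes M: "smooth_manifold M" and p: "p \<in> points M"
    and dim: "finite B" "card B \<le> DIM('e)" "span B = tangent_space M p"
    and u: "u \<in> tangent_space M p"
  shows "\<exists>X\<in>vector_fields M. X p = u"
proof -
  obtain U c where U: "(U, c) \<in> atlas M" and pU: "p \<in> U"
    using M p unfolding smooth_manifold_def by blast
  let ?y = "c p"
  have opn: "open (c ` U)" by (rule chart_open_image[OF M U])
  have y: "?y \<in> c ` U" using pU by blast
  obtain r where r: "r > 0" "cball ?y r \<subseteq> c ` U"
    using opn y open_contains_cball by blast
  let ?b = "bump ?y r"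
  have b: "smooth_on (c ` U) ?b"
    using opn by (auto simp: smooth_on_def intro: Ck_on_bump)
  let ?X = "cutoff_field M U c ?b"
  have X: "?X v \<in> vector_fields M" for v
    using r by (intro cutoff_field_vector_field[OF M U b compact_cball]) (auto simp: bump_outside_cball)
  define L where "L = (\<lambda>v. ?X v p)"
  have lin: "linear L"
  proof
    have *: "linear (frechet_derivative (f \<circ> inv_into U c) (at ?y))" if "f \<in> smooth_functions M" for f
      using smooth_functions_has_derivative[OF that U y] has_derivative_linear by blast
    show "L (v + w) = L v + L w" for v w
      using linear_add[OF *] by (auto simp: L_def cutoff_field_def fun_eq_iff distrib_left)
    show "L (a *\<^sub>R v) = a *\<^sub>R L v" for a v
      using linear_scale[OF *] by (auto simp: L_def cutoff_field_def fun_eq_iff scaleR_fun_def)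
  qed
  have "v = 0" if "L v = 0" for v
  proof (rule euclidean_eqI)
    fix w :: 'e
    let ?H = "\<lambda>y. ?b y * ((y + - ?y) \<bullet> w)"
    define h where "h = (\<lambda>q. if q \<in> U then ?H (c q) else 0)"
    have "smooth_on (c ` U) ?H"
      unfolding smooth_on_def
      by (intro allI Ck_on_mult Ck_on_bump Ck_on_inner Ck_on_add Ck_on_id Ck_on_const opn)
    then have h: "h \<in> smooth_functions M"
      unfolding h_def using r
      by (intro smooth_functions_extend_by_zero[OF M U _ compact_cball r(2)])
        (auto simp: bump_outside_cball)
    have "Ck_on (Suc 0) (c ` U) ?b" using b unfolding smooth_on_def by blast
    then obtain b' where b': "(?b has_derivative b') (at ?y)"
      using Ck_on_SucD(1) y by blast
    have "(?H has_derivative (\<lambda>v. ?b ?y * (v \<bullet> w))) (at ?y)"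
      by (rule has_derivative_eq_rhs[OF has_derivative_mult[OF b']])
        (auto intro!: derivative_eq_intros)
    then have "((h \<circ> inv_into U c) has_derivative (\<lambda>v. ?b ?y * (v \<bullet> w))) (at ?y)"
      by (rule has_derivative_transform_within_open[OF _ opn y])
        (use chart_inj[OF M U] in \<open>auto simp: h_def\<close>)
    then have "frechet_derivative (h \<circ> inv_into U c) (at ?y) = (\<lambda>v. ?b ?y * (v \<bullet> w))"
      by (rule frechet_derivative_at[symmetric])
    then have "L v h = ?b ?y * (?b ?y * (v \<bullet> w))"
      using h pU by (simp add: L_def cutoff_field_def)
    then show "v \<bullet> w = 0 \<bullet> w"
      using \<open>L v = 0\<close> bump_center[OF r(1), of ?y] by simp
  qed
  then have inj: "inj L" using linear_injective_0[OF lin] by blast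
  let ?C = "L ` Basis"
  have ind: "independent ?C"
    using linear_independent_injective_image[OF lin independent_Basis] inj
    by (meson inj_on_subset subset_UNIV)
  have cardC: "card ?C = DIM('e)"
    using inj by (meson card_image inj_on_subset subset_UNIV)
  have "?C \<subseteq> span B"
    using dim(3) cutoff_field_tangent[OF M U] by (auto simp: L_def)
  then have sub: "insert u ?C \<subseteq> span B"
    using dim(3) u by simp
  have "u \<in> span ?C"
  proof (rule ccontr)
    assume u': "u \<notin> span ?C"
    then have "independent (insert u ?C)"
      using ind by (simp add: independent_insert)
    from independent_span_bound[OF dim(1) this sub] have "card (insert u ?C) \<le> card B" ..
    moreover have "u \<notin> ?C"
      using u' by (rule contrapos_nn) (rule span_base)
    ultimately show False
      using cardC dim(2) by simp
  qed
  also have "span ?C = range L"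
    using linear_span_image[OF lin, of Basis] by simp
  finally show ?thesis
    using X by (auto simp: L_def)
qed

section \<open>Yamabe almost solitons with vertical potential\<close>

text \<open>Fields and functions are constrained only at the points of \<open>M\<close>, but derivations and connections
  take total functions as arguments.  The next lemmas show that the values off \<open>M\<close> are
  immaterial.\<close>

lemma smooth_functions_vanishing:
  assumes M: "smooth_manifold M" and "\<And>q. q \<in> points M \<Longrightarrow> f q = 0"
  shows "f \<in> smooth_functions M"
proof -
  have "Ck_on k (c ` U) (f \<circ> inv_into U c)" if U: "(U, c) \<in> atlas M" for U c k
  proof (rule Ck_on_cong[OF chart_open_image[OF M U] _ Ck_on_const[OF chart_open_image[OF M U]]])
    fix y assume "y \<in> c ` U"
    then have "inv_into U c y \<in> points M"
      using chart_subset[OF M U] inv_into_into by (metis subsetD)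
    then show "0 = (f \<circ> inv_into U c) y"
      by (simp add: assms(2))
  qed
  then show ?thesis by (auto simp: smooth_functions_def smooth_on_def)
qed

text \<open>The indicator function \<open>u\<close> of the complement of \<open>points M\<close> is smooth, and \<open>f = f u\<close>; both factors
  vanish at \<open>p\<close>, so that the Leibniz rule gives \<open>0\<close>.\<close>

lemma tangent_vector_vanishing:
  assumes M: "smooth_manifold M" and p: "p \<in> points M" and v: "v \<in> tangent_space M p"
    and f: "\<And>q. q \<in> points M \<Longrightarrow> f q = 0"
  shows "v f = 0"
proof -
  let ?u = "\<lambda>q. if q \<in> points M then 0 else 1 :: real"
  have "f \<in> smooth_functions M" "?u \<in> smooth_functions M"
    using smooth_functions_vanishing[OF M] f by auto
  then have "v (f * ?u) = f p * v ?u + ?u p * v f"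
    using v unfolding tangent_space_def by blast
  moreover have "f * ?u = f" using f by (auto simp: fun_eq_iff)
  ultimately show ?thesis using f p by simp
qed

text \<open>The same indicator function gives \<open>Y = u Y\<close>, to which the Leibniz rule of the connection
  applies.\<close>

lemma affine_connection_vanishing:
  assumes M: "smooth_manifold M" and nabla: "affine_connection M nabla" and p: "p \<in> points M"
    and X: "X \<in> vector_fields M" and Y: "Y \<in> vector_fields M"
    and zero: "\<And>q. q \<in> points M \<Longrightarrow> Y q = 0"
  shows "nabla X Y p = 0"
proof -
  let ?u = "\<lambda>q. if q \<in> points M then 0 else 1 :: real"
  have "?u \<in> smooth_functions M"
    using smooth_functions_vanishing[OF M] by auto
  moreover have "nabla X (\<lambda>q. f q *\<^sub>R Y q) p = X p f *\<^sub>R Y p + f p *\<^sub>R nabla X Y p"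
    if "f \<in> smooth_functions M" for f
    using nabla X Y p that unfolding affine_connection_def by blast
  ultimately have "nabla X (\<lambda>q. ?u q *\<^sub>R Y q) p = X p ?u *\<^sub>R Y p + ?u p *\<^sub>R nabla X Y p"
    by blast
  moreover have "(\<lambda>q. ?u q *\<^sub>R Y q) = Y" using zero by (auto simp: fun_eq_iff scaleR_fun_def)
  ultimately show ?thesis using p zero by simp
qed

lemma subspace_tangent_space:
  assumes "has_signature (tangent_space M p) b r s"
  shows "subspace (tangent_space M p)"
  using assms subspace_span unfolding has_signature_def by metis

locale sasaki_like_accR =
  fixes M :: "('a, 'e::euclidean_space) charted_space"
    and n :: nat
    and \<phi> :: "'a endo_field" and \<xi> :: "'a vfield" and \<eta> :: "'a form_field"
    and g :: "'a bilinear_field" and nabla :: "'a connection"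
  assumes accR: "accR_manifold M n \<phi> \<xi> \<eta> g"
    and levi_civita: "levi_civita_connection M g nabla"
    and sasaki_like: "sasaki_like M \<phi> \<xi> \<eta> g nabla"
begin

lemma manifold: "smooth_manifold M"
  and xi_vector_field: "\<xi> \<in> vector_fields M"
  and phi_vector_field: "X \<in> vector_fields M \<Longrightarrow> (\<lambda>p. \<phi> p (X p)) \<in> vector_fields M"
  and nabla_vector_field: "\<lbrakk>X \<in> vector_fields M; Y \<in> vector_fields M\<rbrakk> \<Longrightarrow> nabla X Y \<in> vector_fields M"
  and affine: "affine_connection M nabla"
  using accR levi_civita
  by (auto simp: accR_manifold_def endomorphism_field_def levi_civita_connection_def
      affine_connection_def)

lemma vector_field_tangent: "\<lbrakk>X \<in> vector_fields M; p \<in> points M\<rbrakk> \<Longrightarrow> X p \<in> tangent_space M p"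
  by (simp add: vector_fields_def)

lemma signature: "p \<in> points M \<Longrightarrow> has_signature (tangent_space M p) (g p) (n + 1) n"
  and metric_linear: "\<lbrakk>p \<in> points M; x \<in> tangent_space M p\<rbrakk> \<Longrightarrow>
    linear_map_on (tangent_space M p) (g p x)"
  and metric_sym: "\<lbrakk>p \<in> points M; x \<in> tangent_space M p; y \<in> tangent_space M p\<rbrakk> \<Longrightarrow>
    g p x y = g p y x"
  and phi_tangent: "\<lbrakk>p \<in> points M; x \<in> tangent_space M p\<rbrakk> \<Longrightarrow> \<phi> p x \<in> tangent_space M p"
  and phi_phi: "\<lbrakk>p \<in> points M; x \<in> tangent_space M p\<rbrakk> \<Longrightarrow> \<phi> p (\<phi> p x) = - x + \<eta> p x *\<^sub>R \<xi> p"
  and eta_phi: "\<lbrakk>p \<in> points M; x \<in> tangent_space M p\<rbrakk> \<Longrightarrow> \<eta> p (\<phi> p x) = 0"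
  and phi_xi: "p \<in> points M \<Longrightarrow> \<phi> p (\<xi> p) = 0"
  and eta_xi: "p \<in> points M \<Longrightarrow> \<eta> p (\<xi> p) = 1"
  and metric_phi_phi: "\<lbrakk>p \<in> points M; x \<in> tangent_space M p; y \<in> tangent_space M p\<rbrakk> \<Longrightarrow>
    g p (\<phi> p x) (\<phi> p y) = - g p x y + \<eta> p x * \<eta> p y"
  using accR
  by (auto simp: accR_manifold_def pseudo_riemannian_metric_def one_form_def
      endomorphism_field_def)

lemma tangent_subspace: "p \<in> points M \<Longrightarrow> subspace (tangent_space M p)"
  by (rule subspace_tangent_space[OF signature])

lemma linear_map_on_simps:
  assumes p: "p \<in> points M" and T: "linear_map_on (tangent_space M p) T"
  shows "T 0 = 0" and "x \<in> tangent_space M p \<Longrightarrow> T (- x) = - T x"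
    and "\<lbrakk>x \<in> tangent_space M p; y \<in> tangent_space M p\<rbrakk> \<Longrightarrow> T (x - y) = T x - T y"
proof -
  have sub: "subspace (tangent_space M p)" by (rule tangent_subspace[OF p])
  show "T 0 = 0"
    using T subspace_0[OF sub] unfolding linear_map_on_def by (metis scale_zero_left)
  show neg: "T (- x) = - T x" if "x \<in> tangent_space M p" for x
    using T that unfolding linear_map_on_def by (metis scaleR_minus1_left)
  show "T (x - y) = T x - T y" if "x \<in> tangent_space M p" "y \<in> tangent_space M p"
  proof -
    have "T (x + - y) = T x + T (- y)"
      using T that(1) subspace_neg[OF sub that(2)] unfolding linear_map_on_def by blast
    then show ?thesis
      using neg[OF that(2)] by simp
  qed
qed

lemma metric_xi:
  assumes p: "p \<in> points M" and x: "x \<in> tangent_space M p"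
  shows "g p x (\<xi> p) = \<eta> p x"
  using metric_phi_phi[OF p x vector_field_tangent[OF xi_vector_field p]]
    linear_map_on_simps(1)[OF p metric_linear[OF p phi_tangent[OF p x]]]
  by (simp add: phi_xi[OF p] eta_xi[OF p])

text \<open>The summand \<open>\<eta>(x) \<xi>\<close> of \<open>\<phi>\<^sup>2 x\<close> contributes nothing, since \<open>\<xi>\<close> is orthogonal to the image of
  \<open>\<phi>\<close>.\<close>

lemma metric_phi_left:
  assumes p: "p \<in> points M" and x: "x \<in> tangent_space M p" and y: "y \<in> tangent_space M p"
  shows "g p (\<phi> p (\<phi> p x)) (\<phi> p y) = - g p x (\<phi> p y)"
proof -
  note xi = vector_field_tangent[OF xi_vector_field p]
  note fy = phi_tangent[OF p y]
  have sub: "subspace (tangent_space M p)" by (rule tangent_subspace[OF p])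
  have "g p (\<phi> p (\<phi> p x)) (\<phi> p y) = g p (\<phi> p y) (\<eta> p x *\<^sub>R \<xi> p - x)"
    using metric_sym[OF p phi_tangent[OF p phi_tangent[OF p x]] fy] phi_phi[OF p x] by simp
  also have "\<dots> = g p (\<phi> p y) (\<eta> p x *\<^sub>R \<xi> p) - g p (\<phi> p y) x"
    by (rule linear_map_on_simps(3)[OF p metric_linear[OF p fy] subspace_scale[OF sub xi] x])
  also have "g p (\<phi> p y) (\<eta> p x *\<^sub>R \<xi> p) = 0"
    using metric_linear[OF p fy] xi metric_xi[OF p fy] eta_phi[OF p y]
    unfolding linear_map_on_def by simp
  finally show ?thesis
    using metric_sym[OF p x fy] by simp
qed

lemma metric_phi_swap:
  assumes p: "p \<in> points M" and x: "x \<in> tangent_space M p" and y: "y \<in> tangent_space M p"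
  shows "g p (\<phi> p x) y = g p x (\<phi> p y)"
  using metric_phi_phi[OF p phi_tangent[OF p x] y] metric_phi_left[OF p x y] eta_phi[OF p x] by simp

text \<open>The horizontal part of \<open>\<nabla>\<^sub>X \<xi> = - \<phi> X\<close>.  With \<open>Y = \<xi>\<close> the Sasaki-like condition reads
  \<open>\<phi> (\<nabla>\<^sub>X \<xi>) = - \<phi>\<^sup>2 X\<close>, because \<open>\<phi> \<xi> = 0\<close>; the claim follows since \<open>\<phi>\<close> is self-adjoint for \<open>g\<close>.\<close>

lemma metric_nabla_xi:
  assumes X: "X \<in> vector_fields M" and p: "p \<in> points M" and y: "y \<in> tangent_space M p"
  shows "g p (nabla X \<xi> p) (\<phi> p y) = - g p (\<phi> p (X p)) (\<phi> p y)"
proof -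
  note x = vector_field_tangent[OF X p]
  have DX: "nabla X \<xi> p \<in> tangent_space M p"
    by (intro vector_field_tangent nabla_vector_field X p xi_vector_field)
  have "nabla X (\<lambda>q. \<phi> q (\<xi> q)) p = 0"
    by (rule affine_connection_vanishing[OF manifold affine p X phi_vector_field[OF xi_vector_field]])
      (rule phi_xi)
  then have "- \<phi> p (nabla X \<xi> p) = \<phi> p (\<phi> p (X p))"
    using sasaki_like X xi_vector_field p
      linear_map_on_simps(1)[OF p metric_linear[OF p phi_tangent[OF p x]]]
    by (fastforce simp: sasaki_like_def covariant_derivative_endo_def phi_xi eta_xi)
  then have eq: "\<phi> p (nabla X \<xi> p) = - \<phi> p (\<phi> p (X p))"
    by (metis minus_minus)
  have "g p (nabla X \<xi> p) (\<phi> p y) = g p y (\<phi> p (nabla X \<xi> p))"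
    using metric_phi_swap[OF p DX y] metric_sym[OF p y phi_tangent[OF p DX]] by simp
  also have "\<dots> = - g p y (\<phi> p (\<phi> p (X p)))"
    unfolding eq by (intro linear_map_on_simps(2)[OF p] metric_linear[OF p y] phi_tangent p x)
  also have "\<dots> = - g p (\<phi> p (X p)) (\<phi> p y)"
    using metric_phi_swap[OF p y phi_tangent[OF p x]]
      metric_sym[OF p phi_tangent[OF p y] phi_tangent[OF p x]] by simp
  finally show ?thesis .
qed

lemma metric_derivative:
  assumes "X \<in> vector_fields M" "Y \<in> vector_fields M" "Z \<in> vector_fields M" "p \<in> points M"
  shows "X p (\<lambda>q. g q (Y q) (Z q)) = g p (nabla X Y p) (Z p) + g p (Y p) (nabla X Z p)"
  using levi_civita assms unfolding levi_civita_connection_def by blast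

text \<open>The Leibniz term \<open>dk(X) \<xi>\<close> of \<open>\<nabla>\<^sub>X (k \<xi>)\<close> is orthogonal to a horizontal \<open>Y\<close>.  Differentiating the
  identities \<open>g(\<theta>, Y) = 0\<close> and \<open>g(\<xi>, Y) = 0\<close> shows this without writing the term: both sides
  equal \<open>- g(\<theta>, \<nabla>\<^sub>X Y)\<close>.\<close>

lemma vertical_field_derivative:
  assumes \<theta>: "\<theta> \<in> vector_fields M" "\<And>q. q \<in> points M \<Longrightarrow> \<theta> q = k q *\<^sub>R \<xi> q"
    and X: "X \<in> vector_fields M" and Y: "Y \<in> vector_fields M" and p: "p \<in> points M"
    and hor: "\<And>q. q \<in> points M \<Longrightarrow> \<eta> q (Y q) = 0"
  shows "g p (nabla X \<theta> p) (Y p) = k p * g p (nabla X \<xi> p) (Y p)"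
proof -
  have \<xi>Y: "g q (\<xi> q) (Y q) = 0" if q: "q \<in> points M" for q
    using metric_xi[OF q vector_field_tangent[OF Y q]] hor[OF q]
      metric_sym[OF q vector_field_tangent[OF xi_vector_field q] vector_field_tangent[OF Y q]] by simp
  have kg: "g q (k q *\<^sub>R \<xi> q) z = k q * g q (\<xi> q) z"
    if q: "q \<in> points M" and z: "z \<in> tangent_space M q" for q z
  proof -
    have t: "\<theta> q \<in> tangent_space M q" and x: "\<xi> q \<in> tangent_space M q"
      using \<theta>(1) xi_vector_field vector_field_tangent q by auto
    show ?thesis
      using metric_sym[OF q t z] metric_sym[OF q x z] metric_linear[OF q z] x \<theta>(2)[OF q]
      unfolding linear_map_on_def by simp
  qed
  have \<theta>Y: "g q (\<theta> q) (Y q) = 0" if q: "q \<in> points M" for q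
    using kg[OF q vector_field_tangent[OF Y q]] \<xi>Y[OF q] \<theta>(2)[OF q] by simp
  have "X p (\<lambda>q. g q (\<xi> q) (Y q)) = 0" "X p (\<lambda>q. g q (\<theta> q) (Y q)) = 0"
    using tangent_vector_vanishing[OF manifold p vector_field_tangent[OF X p]] \<xi>Y \<theta>Y by auto
  then show ?thesis
    using metric_derivative[OF X xi_vector_field Y p] metric_derivative[OF X \<theta>(1) Y p]
      kg[OF p vector_field_tangent[OF nabla_vector_field[OF X Y] p]] \<theta>(2)[OF p]
    by (simp add: add_eq_0_iff)
qed

text \<open>The Lie brackets are replaced by the torsion-free connection, and metricity cancels the terms
  containing \<open>\<nabla>\<^sub>T X\<close> and \<open>\<nabla>\<^sub>T Y\<close>.\<close>

lemma lie_derivative_nabla: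
  assumes T: "T \<in> vector_fields M" and X: "X \<in> vector_fields M" and Y: "Y \<in> vector_fields M"
    and p: "p \<in> points M"
  shows "lie_derivative T g X Y p = g p (nabla X T p) (Y p) + g p (X p) (nabla Y T p)"
proof -
  have sub: "subspace (tangent_space M p)" by (rule tangent_subspace[OF p])
  have br: "lie_bracket T Z p = nabla T Z p - nabla Z T p" if "Z \<in> vector_fields M" for Z
    using levi_civita T that p unfolding levi_civita_connection_def by simp
  have tan: "nabla T Z p \<in> tangent_space M p" "nabla Z T p \<in> tangent_space M p"
    "Z p \<in> tangent_space M p" if "Z \<in> vector_fields M" for Z
    using that T p nabla_vector_field vector_field_tangent by auto
  have *: "g p w (lie_bracket T Z p) = g p w (nabla T Z p) - g p w (nabla Z T p)"
    if "w \<in> tangent_space M p" "Z \<in> vector_fields M" for w Z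
    unfolding br[OF that(2)]
    by (rule linear_map_on_simps(3)[OF p metric_linear[OF p that(1)] tan(1,2)[OF that(2)]])
  have "lie_bracket T X p \<in> tangent_space M p"
    using br[OF X] tan[OF X] subspace_diff[OF sub] by metis
  then have "g p (lie_bracket T X p) (Y p) = g p (nabla T X p) (Y p) - g p (nabla X T p) (Y p)"
    using *[OF tan(3)[OF Y] X] metric_sym[OF p _ tan(3)[OF Y]] tan[OF X] by simp
  then show ?thesis
    using *[OF tan(3)[OF X] Y] metric_derivative[OF T X Y p]
    by (simp add: lie_derivative_def)
qed

text \<open>On the horizontal fields \<open>\<phi> X\<close> and \<open>\<phi> Y\<close> the form \<open>- 2 k g(\<phi> _, _)\<close> becomes
  \<open>- 2 k g(\<phi>\<^sup>2 X, \<phi> Y) = 2 k g(X, \<phi> Y)\<close>.\<close>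

lemma lie_derivative_vertical:
  assumes \<theta>: "\<theta> \<in> vector_fields M" "\<And>q. q \<in> points M \<Longrightarrow> \<theta> q = k q *\<^sub>R \<xi> q"
    and X: "X \<in> vector_fields M" and Y: "Y \<in> vector_fields M" and p: "p \<in> points M"
  shows "lie_derivative \<theta> g (\<lambda>q. \<phi> q (X q)) (\<lambda>q. \<phi> q (Y q)) p = 2 * k p * g p (X p) (\<phi> p (Y p))"
proof -
  let ?X = "\<lambda>q. \<phi> q (X q)" and ?Y = "\<lambda>q. \<phi> q (Y q)"
  note X' = phi_vector_field[OF X] and Y' = phi_vector_field[OF Y]
  note x = vector_field_tangent[OF X p] and y = vector_field_tangent[OF Y p]
  have hor: "\<eta> q (\<phi> q (Z q)) = 0" if "Z \<in> vector_fields M" "q \<in> points M" for Z q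
    using eta_phi vector_field_tangent that by blast
  have *: "g p (nabla (\<lambda>q. \<phi> q (V q)) \<theta> p) (\<phi> p (W p)) = k p * g p (V p) (\<phi> p (W p))"
    if V: "V \<in> vector_fields M" and W: "W \<in> vector_fields M" for V W
    using vertical_field_derivative[OF \<theta> phi_vector_field[OF V] phi_vector_field[OF W] p hor[OF W]]
      metric_nabla_xi[OF phi_vector_field[OF V] p vector_field_tangent[OF W p]]
      metric_phi_left[OF p vector_field_tangent[OF V p] vector_field_tangent[OF W p]] by simp
  have "g p (\<phi> p (X p)) (nabla ?Y \<theta> p) = k p * g p (Y p) (\<phi> p (X p))"
    using *[OF Y X] metric_sym[OF p phi_tangent[OF p x]]
      vector_field_tangent[OF nabla_vector_field[OF Y' \<theta>(1)] p] by simp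
  also have "\<dots> = k p * g p (X p) (\<phi> p (Y p))"
    using metric_phi_swap[OF p x y] metric_sym[OF p y phi_tangent[OF p x]] by simp
  finally show ?thesis
    using lie_derivative_nabla[OF \<theta>(1) X' Y' p] *[OF X Y] by simp
qed

lemma tangent_vector_extension:
  assumes p: "p \<in> points M" and u: "u \<in> tangent_space M p"
  shows "\<exists>X\<in>vector_fields M. X p = u"
proof -
  obtain e where "span (e ` {..<n + 1 + n}) = tangent_space M p"
    using signature[OF p] unfolding has_signature_def by blast
  moreover have "card (e ` {..<n + 1 + n}) \<le> DIM('e)"
    using card_image_le[of "{..<n + 1 + n}" e] accR by (simp add: accR_manifold_def)
  ultimately show ?thesis
    using tangent_vector_extends[OF manifold p] u by blast
qed

text \<open>Otherwise \<open>g = \<eta> \<otimes> \<eta>\<close> would have rank one; but \<open>n \<ge> 1\<close> provides two orthonormal vectors of positive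
  square.\<close>

lemma metric_phi_phi_nonzero:
  assumes p: "p \<in> points M"
  shows "\<exists>x\<in>tangent_space M p. \<exists>y\<in>tangent_space M p. g p (\<phi> p x) (\<phi> p y) \<noteq> 0"
proof (rule ccontr)
  assume "\<not> ?thesis"
  then have eq: "g p x y = \<eta> p x * \<eta> p y" if "x \<in> tangent_space M p" "y \<in> tangent_space M p" for x y
    using metric_phi_phi[OF p] that by fastforce
  obtain e :: "nat \<Rightarrow> 'a tangent_vector" where e: "\<forall>i<n + 1 + n. e i \<in> tangent_space M p"
    and ortho: "\<forall>i<n + 1 + n. \<forall>j<n + 1 + n. g p (e i) (e j) =
      (if i \<noteq> j then 0 else if i < n + 1 then 1 else - 1)"
    using signature[OF p] unfolding has_signature_def by metis
  have "n \<ge> 1" using accR by (simp add: accR_manifold_def)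
  then have "e 0 \<in> tangent_space M p" "e 1 \<in> tangent_space M p"
    "g p (e 0) (e 0) = 1" "g p (e 1) (e 1) = 1" "g p (e 0) (e 1) = 0"
    using e ortho by auto
  then show False using eq by auto
qed

text \<open>For the bilinear form \<open>G(v, w) = g(\<phi> v, \<phi> w)\<close> the conformality condition, used for \<open>(x, y)\<close> and for
  \<open>(\<phi> x, y)\<close>, yields \<open>(k\<^sup>2 + c\<^sup>2) G(x, y) = 0\<close>.  This is the statement that the real number \<open>- c / k\<close>
  cannot square to \<open>-1\<close>, in a form that needs no division by \<open>k\<close>.\<close>

lemma no_vertical_conformal_field:
  assumes \<theta>: "\<theta> \<in> vector_fields M" "\<And>q. q \<in> points M \<Longrightarrow> \<theta> q = k q *\<^sub>R \<xi> q"
    and p: "p \<in> points M"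
    and conf: "\<And>X Y. \<lbrakk>X \<in> vector_fields M; Y \<in> vector_fields M\<rbrakk> \<Longrightarrow>
      1 / 2 * lie_derivative \<theta> g X Y p = c * g p (X p) (Y p)"
  shows "k p = 0"
proof -
  obtain x y where x: "x \<in> tangent_space M p" and y: "y \<in> tangent_space M p"
    and nz: "g p (\<phi> p x) (\<phi> p y) \<noteq> 0"
    using metric_phi_phi_nonzero[OF p] by blast
  have *: "k p * g p v (\<phi> p w) = c * g p (\<phi> p v) (\<phi> p w)"
    if v: "v \<in> tangent_space M p" and w: "w \<in> tangent_space M p" for v w
  proof -
    obtain X Y where "X \<in> vector_fields M" "Y \<in> vector_fields M" "X p = v" "Y p = w"
      using tangent_vector_extension[OF p] v w by meson
    then show ?thesis
      using lie_derivative_vertical[OF \<theta>, of X Y p] conf[of "\<lambda>q. \<phi> q (X q)" "\<lambda>q. \<phi> q (Y q)"]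
        phi_vector_field p by simp
  qed
  have "k p * g p (\<phi> p x) (\<phi> p y) = - c * g p x (\<phi> p y)"
    using *[OF phi_tangent[OF p x] y] metric_phi_left[OF p x y] by simp
  then have "k p * (k p * g p (\<phi> p x) (\<phi> p y)) = - c * (k p * g p x (\<phi> p y))"
    by simp
  also have "\<dots> = - c * (c * g p (\<phi> p x) (\<phi> p y))"
    using *[OF x y] by simp
  finally have "(k p * k p + c * c) * g p (\<phi> p x) (\<phi> p y) = 0"
    by (simp add: algebra_simps)
  then show ?thesis
    using nz by (simp add: sum_squares_eq_zero_iff)
qed

end

theorem theorem4p1:
  fixes M :: "('a, 'e::euclidean_space) charted_space"
    and n :: nat
    and \<phi> :: "'a endo_field" and \<xi> :: "'a vfield" and \<eta> :: "'a form_field"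
    and g :: "'a bilinear_field" and nabla :: "'a connection"
  assumes "accR_manifold M n \<phi> \<xi> \<eta> g"
    and "levi_civita_connection M g nabla"
    and "sasaki_like M \<phi> \<xi> \<eta> g nabla"
  shows "\<not> (\<exists>\<theta> l. yamabe_almost_soliton M g nabla \<theta> l \<and> vertical_potential M \<xi> \<theta>)"
proof
  interpret sasaki_like_accR M n \<phi> \<xi> \<eta> g nabla
    using assms by unfold_locales
  assume "\<exists>\<theta> l. yamabe_almost_soliton M g nabla \<theta> l \<and> vertical_potential M \<xi> \<theta>"
  then obtain \<theta> l k where sol: "yamabe_almost_soliton M g nabla \<theta> l"
    and k: "\<And>q. q \<in> points M \<Longrightarrow> k q \<noteq> 0" "\<And>q. q \<in> points M \<Longrightarrow> \<theta> q = k q *\<^sub>R \<xi> q"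
    unfolding vertical_potential_def by blast
  obtain p where p: "p \<in> points M"
    using manifold unfolding smooth_manifold_def by blast
  have "k p = 0"
    by (rule no_vertical_conformal_field[OF _ k(2) p, where c = "scalar_curvature M g nabla p - l p"])
      (use sol p in \<open>auto simp: yamabe_almost_soliton_def\<close>)
  then show False using k(1) p by blast
qed

end
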